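(* Let $A\in\mathbb{R}^{n\times n}$, and let $\mathcal{C}\subseteq\mathbb{R}^n$ be a proper cone. Assume that $\mathcal{C}$ is an invariant set for the continuous system $\dot{x}(t)=Ax(t)$. Let $\bar\tau=\sup\{\tau : I-A\Delta t \text{ is nonsingular for every } \Delta t\in[0,\tau]\}$. Then for every $x_k\in\mathcal{C}$ and every $\Delta t\in[0,\bar\tau)$, we have $x_{k+1}\in\mathcal{C}$, where $x_{k+1}=(I-\Delta t A)^{-1}x_k$ is obtained by the backward Euler method; i.e., $\mathcal{C}$ is an invariant set for the discrete system $x_{k+1}=(I-\Delta t A)^{-1}x_k$ for every such $\Delta t$.
   Context: A convex cone $\mathcal{C}$ is called proper if it is nonempty, closed, and pointed (pointed: $\mathcal{C}\cap(-\mathcal{C})=\{0\}$). A set $\mathcal{S}$ is an invariant set for $\dot x(t)=Ax(t)$ if $x(0)\in\mathcal{S}$ implies $x(t)\in\mathcal{S}$ for all $t\ge0$. It is an invariant set for a discrete system $x_{k+1}=Mx_k$ if $x_k\in\mathcal{S}$ implies $x_{k+1}\in\mathcal{S}$ for all $k\in\mathbb{N}$. In the definition of $\bar\tau$, $\tau$ ranges over nonnegative reals, and $\bar\tau$ may be $+\infty$. *)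

theory Defs
  imports "HOL-Analysis.Analysis"
begin

(* The library's convex_cone already includes nonemptiness.  No interior is required. *)
definition proper_cone :: "(real^'n) set \<Rightarrow> bool" where
  "proper_cone C \<longleftrightarrow> convex_cone C \<and> closed C \<and> C \<inter> uminus ` C = {0}"

(* Solutions are differentiable on [0, \<infinity>), with a one-sided derivative at 0. *)
definition solves_linear_ode :: "real^'n^'n \<Rightarrow> (real \<Rightarrow> real^'n) \<Rightarrow> bool" where
  "solves_linear_ode A x \<longleftrightarrow>
     (\<forall>t\<ge>0. (x has_vector_derivative A *v x t) (at t within {0..}))"

definition invariant_continuous :: "(real^'n) set \<Rightarrow> real^'n^'n \<Rightarrow> bool" where
  "invariant_continuous S A \<longleftrightarrow>
     (\<forall>x. solves_linear_ode A x \<longrightarrow> x 0 \<in> S \<longrightarrow> (\<forall>t\<ge>0. x t \<in> S))"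

definition invariant_discrete :: "(real^'n) set \<Rightarrow> real^'n^'n \<Rightarrow> bool" where
  "invariant_discrete S M \<longleftrightarrow>
     (\<forall>x :: nat \<Rightarrow> real^'n. (\<forall>k. x (Suc k) = M *v x k) \<longrightarrow>
        (\<forall>k. x k \<in> S \<longrightarrow> x (Suc k) \<in> S))"

(* The set below always contains 0, so the supremum is nonnegative; it may be \<infinity>. *)
definition tau_bar :: "real^'n^'n \<Rightarrow> ereal" where
  "tau_bar A = Sup {ereal \<tau> | \<tau>. 0 \<le> \<tau> \<and> (\<forall>\<Delta>t\<in>{0..\<tau>}. invertible (mat 1 - \<Delta>t *\<^sub>R A))}"

definition backward_euler :: "real^'n^'n \<Rightarrow> real \<Rightarrow> real^'n^'n" where
  "backward_euler A \<Delta>t = matrix_inv (mat 1 - \<Delta>t *\<^sub>R A)"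

end

theory Submission
  imports Defs
begin

text \<open>
  A backward Euler step from \<open>y \<in> C\<close> solves \<open>(I - t A) z = y\<close>.  That \<open>z\<close> lies in \<open>C\<close> is shown by
  estimating its distance to the nearest point \<open>p\<close> of \<open>C\<close> in terms of that same distance.

  The vector \<open>z - p\<close> is an outward normal of \<open>C\<close> at \<open>p\<close>.  The trajectory starting at \<open>p\<close>, which
  exists as a convergent exponential series, stays in \<open>C\<close>, so its initial velocity \<open>A p\<close> cannot point outwards: \<open>(z - p) \<bullet> A p \<le> 0\<close>.
  Taking the inner product of \<open>z = y + t A z\<close> with \<open>z - p\<close> gives
  \<open>\<parallel>z - p\<parallel>\<^sup>2 \<le> t \<parallel>A\<parallel> \<parallel>z - p\<parallel>\<^sup>2\<close>, so \<open>z = p \<in> C\<close> once \<open>t \<parallel>A\<parallel> < 1\<close>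
  (\<open>inverse_positive_small_step\<close>).

  The property then spreads to larger steps.  For \<open>0 < s \<le> t\<close>,
  \<open>(I - s A) z = (s/t) y + (1 - s/t) z\<close>.  Replacing \<open>z\<close> by \<open>p\<close> on the right-hand side gives an
  element of \<open>C\<close>, whose preimage \<open>u\<close> under \<open>I - s A\<close> lies in \<open>C\<close> if the property holds at \<open>s\<close>.
  Its distance to \<open>z\<close> is at most \<open>(1 - s/t) \<parallel>(I - s A)\<^sup>-\<^sup>1\<parallel> \<parallel>z - p\<parallel>\<close>.  When the factor is below
  one, \<open>u\<close> would be nearer to \<open>z\<close> than \<open>p\<close> is, unless \<open>z = p\<close>
  (\<open>inverse_positive_larger_step\<close>).  On a compact interval of nonsingular step sizes the
  inverses are uniformly bounded (\<open>uniform_inverse_bound\<close>), so the ratio \<open>t/s\<close> can be fixed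
  and every step size in the interval is reached after finitely many enlargements.
\<close>

section \<open>Existence of solutions\<close>

lemma bounded_matrix_vector_mult:
  fixes A :: "real^'n^'n"
  obtains B where "0 < B" "\<And>x. norm (A *v x) \<le> B * norm x"
  using bounded_linear.pos_bounded[OF matrix_vector_mul_bounded_linear[of A]]
  by (metis mult.commute)

text \<open>The orbit of \<open>p\<close> under the matrix exponential: the sum of \<open>t\<^sup>k A\<^sup>k p / k!\<close>.\<close>
definition exponential_orbit :: "real^'n^'n \<Rightarrow> real^'n \<Rightarrow> real \<Rightarrow> real^'n" where
  "exponential_orbit A p t = (\<chi> i. \<Sum>k. ((((*v) A) ^^ k) p $ i / fact k) * t ^ k)"

lemma summable_exponential_orbit:
  fixes A :: "real^'n^'n"
  shows "summable (\<lambda>k. ((((*v) A) ^^ k) p $ i / fact k) * t ^ k)"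
proof -
  obtain B where B: "0 < B" "\<And>x. norm (A *v x) \<le> B * norm x"
    using bounded_matrix_vector_mult[of A] by blast
  have iterate: "norm ((((*v) A) ^^ k) p) \<le> B ^ k * norm p" for k
  proof (induction k)
    case (Suc k)
    have "norm ((((*v) A) ^^ Suc k) p) \<le> B * norm ((((*v) A) ^^ k) p)"
      using B(2) by simp
    also have "\<dots> \<le> B * (B ^ k * norm p)"
      using Suc B(1) by (intro mult_left_mono) auto
    finally show ?case by (simp add: mult.assoc)
  qed simp
  show ?thesis
  proof (rule summable_comparison_test')
    show "summable (\<lambda>k. norm p * (inverse (fact k) * (B * \<bar>t\<bar>) ^ k))"
      by (intro summable_mult summable_exp)
    fix k :: nat
    have "\<bar>(((*v) A) ^^ k) p $ i\<bar> \<le> B ^ k * norm p"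
      using iterate[of k] component_le_norm_cart[of "(((*v) A) ^^ k) p" i] by linarith
    then have "\<bar>(((*v) A) ^^ k) p $ i\<bar> * (inverse (fact k) * \<bar>t\<bar> ^ k)
        \<le> (B ^ k * norm p) * (inverse (fact k) * \<bar>t\<bar> ^ k)"
      by (intro mult_right_mono) auto
    then show "norm ((((*v) A) ^^ k) p $ i / fact k * t ^ k)
        \<le> norm p * (inverse (fact k) * (B * \<bar>t\<bar>) ^ k)"
      by (simp add: abs_mult power_abs power_mult_distrib field_simps)
  qed
qed

lemma exponential_orbit_0: "exponential_orbit A p 0 = p"
  unfolding exponential_orbit_def powser_zero by (simp add: vec_eq_iff)

lemma solves_linear_ode_exponential_orbit:
  fixes A :: "real^'n^'n"
  shows "solves_linear_ode A (exponential_orbit A p)"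
  unfolding solves_linear_ode_def
proof (intro allI impI)
  fix t :: real
  let ?a = "\<lambda>k. (((*v) A) ^^ k) p"
  have component: "((\<lambda>t. exponential_orbit A p t $ i) has_real_derivative
      (A *v exponential_orbit A p t) $ i) (at t)" for i
  proof -
    let ?c = "\<lambda>k. ?a k $ i / fact k"
    have "((\<lambda>t. \<Sum>k. ?c k * t ^ k) has_real_derivative (\<Sum>k. diffs ?c k * t ^ k)) (at t)"
      by (rule termdiffs_strong[OF summable_exponential_orbit[where t = "\<bar>t\<bar> + 1"]]) simp
    moreover have "(\<Sum>k. diffs ?c k * t ^ k) = (A *v exponential_orbit A p t) $ i"
    proof -
      have "diffs ?c k * t ^ k = (\<Sum>j\<in>UNIV. A $ i $ j * (?a k $ j / fact k * t ^ k))" for k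
      proof -
        have "diffs ?c k = (A *v ?a k) $ i / fact k"
          unfolding diffs_def by (simp del: of_nat_Suc)
        then show ?thesis
          by (simp add: matrix_vector_mult_def sum_divide_distrib sum_distrib_right mult.assoc)
      qed
      then have "(\<Sum>k. diffs ?c k * t ^ k)
          = (\<Sum>k. \<Sum>j\<in>UNIV. A $ i $ j * (?a k $ j / fact k * t ^ k))"
        by simp
      also have "\<dots> = (\<Sum>j\<in>UNIV. \<Sum>k. A $ i $ j * (?a k $ j / fact k * t ^ k))"
        by (rule suminf_sum) (intro summable_mult summable_exponential_orbit)
      also have "\<dots> = (\<Sum>j\<in>UNIV. A $ i $ j * (\<Sum>k. ?a k $ j / fact k * t ^ k))"
        by (intro sum.cong refl suminf_mult summable_exponential_orbit)
      finally show ?thesis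
        by (simp add: matrix_vector_mult_def exponential_orbit_def)
    qed
    ultimately show ?thesis
      by (simp add: exponential_orbit_def)
  qed
  have "(exponential_orbit A p has_vector_derivative A *v exponential_orbit A p t) (at t)"
    unfolding has_vector_derivative_def
  proof (subst has_derivative_componentwise_within, intro ballI)
    fix b :: "real^'n"
    assume "b \<in> Basis"
    then obtain i where b: "b = axis i 1"
      by (auto simp: Basis_vec_def)
    show "((\<lambda>x. exponential_orbit A p x \<bullet> b) has_derivative
        (\<lambda>x. x *\<^sub>R (A *v exponential_orbit A p t) \<bullet> b)) (at t)"
      using component[of i]
      by (simp add: b inner_axis has_field_derivative_def mult_commute_abs)
  qed
  then show "(exponential_orbit A p has_vector_derivative A *v exponential_orbit A p t)
      (at t within {0..})"
    by (rule has_vector_derivative_at_within)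
qed

section \<open>Outward normals and the flow\<close>

text \<open>
  Along the trajectory starting at \<open>p\<close>, the inner product with an outward normal \<open>v\<close> at \<open>p\<close> is
  nonpositive and vanishes at time \<open>0\<close>, so its one-sided derivative there is nonpositive.
\<close>
lemma invariant_continuous_normal_le_0:
  fixes A :: "real^'n^'n"
  assumes "invariant_continuous C A" "p \<in> C"
    and normal: "\<And>c. c \<in> C \<Longrightarrow> v \<bullet> c \<le> 0" "v \<bullet> p = 0"
  shows "v \<bullet> (A *v p) \<le> 0"
proof -
  define x where "x = exponential_orbit A p"
  have x: "solves_linear_ode A x" "x 0 = p"
    unfolding x_def by (simp_all add: solves_linear_ode_exponential_orbit exponential_orbit_0)
  have stays: "x t \<in> C" if "0 \<le> t" for t
    using assms(1,2) x that unfolding invariant_continuous_def by auto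
  have "(x has_vector_derivative A *v p) (at 0 within {0..})"
    using x unfolding solves_linear_ode_def by auto
  then have "((\<lambda>t. v \<bullet> x t) has_derivative (\<lambda>h. v \<bullet> (h *\<^sub>R (A *v p)))) (at 0 within {0..})"
    unfolding has_vector_derivative_def by (rule has_derivative_inner_right)
  then have "((\<lambda>t. v \<bullet> x t) has_real_derivative v \<bullet> (A *v p)) (at 0 within {0..})"
    by (simp add: has_field_derivative_def mult_commute_abs)
  then have "((\<lambda>t. (v \<bullet> x t) / t) \<longlongrightarrow> v \<bullet> (A *v p)) (at 0 within {0..})"
    by (simp add: has_field_derivative_iff x normal)
  moreover have "eventually (\<lambda>t. (v \<bullet> x t) / t \<le> 0) (at 0 within {0..})"
    unfolding eventually_at_filter
    by (intro always_eventually) (auto intro!: divide_nonpos_nonneg normal stays)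
  moreover have "at (0::real) within {0..} \<noteq> bot"
    by (simp add: at_within_Ici_at_right)
  ultimately show ?thesis
    by (rule tendsto_upperbound)
qed

lemma closest_point_convex_cone_normal:
  fixes C :: "('a::euclidean_space) set" and z :: 'a
  assumes "convex_cone C" "closed C"
  defines "p \<equiv> closest_point C z"
  shows "\<And>c. c \<in> C \<Longrightarrow> (z - p) \<bullet> c \<le> 0" "(z - p) \<bullet> p = 0"
proof -
  have C: "C \<noteq> {}" "convex C"
    using assms(1) by (auto simp: convex_cone_def)
  have p: "p \<in> C"
    unfolding p_def using assms(2) C(1) by (rule closest_point_in_set)
  have scale: "a *\<^sub>R p \<in> C" if "0 \<le> a" for a
    using assms(1) p that by (simp add: convex_cone_def conic_def)
  have dot: "(z - p) \<bullet> (c - p) \<le> 0" if "c \<in> C" for c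
    unfolding p_def using closest_point_dot[OF C(2) assms(2) that] .
  show orth: "(z - p) \<bullet> p = 0"
    \<comment> \<open>Both \<open>0\<close> and \<open>2 p\<close> lie in the cone, on opposite sides of \<open>p\<close>.\<close>
    using dot[OF scale[of 0]] dot[OF scale[of 2]] by (simp add: inner_diff_right)
  show "(z - p) \<bullet> c \<le> 0" if "c \<in> C" for c
    using dot[OF that] orth by (simp add: inner_diff_right)
qed

section \<open>Positivity of the implicit step\<close>

text \<open>
  For invertible \<open>M\<close> this says that the inverse of \<open>M\<close> maps \<open>C\<close> into itself; in this form small
  step sizes need no separate proof that \<open>M\<close> is invertible.
\<close>
definition inverse_positive :: "(real^'n) set \<Rightarrow> real^'n^'n \<Rightarrow> bool" where
  "inverse_positive C M \<longleftrightarrow> (\<forall>z. M *v z \<in> C \<longrightarrow> z \<in> C)"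

lemma implicit_step_mult:
  "(mat 1 - t *\<^sub>R A) *v z = z - t *\<^sub>R (A *v z)" for A :: "real^'n^'n"
  by (simp add: matrix_vector_mult_diff_rdistrib scaleR_matrix_vector_assoc)

text \<open>
  Let \<open>p\<close> be the point of \<open>C\<close> nearest to \<open>z\<close>, \<open>v = z - p\<close> and \<open>y = z - t A z\<close>.  In
  \<open>\<parallel>v\<parallel>\<^sup>2 = v \<bullet> z = v \<bullet> y + t (v \<bullet> A v) + t (v \<bullet> A p)\<close> the first and the last term on the right
  are nonpositive, because \<open>v\<close> is an outward normal at \<open>p\<close>; the middle one is at most
  \<open>t B \<parallel>v\<parallel>\<^sup>2\<close>, which is less than the left-hand side unless \<open>v = 0\<close>.
\<close>
lemma inverse_positive_small_step:
  fixes A :: "real^'n^'n"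
  assumes "convex_cone C" "closed C" "invariant_continuous C A"
    and B: "\<And>x. norm (A *v x) \<le> B * norm x"
    and "0 \<le> t" "t * B < 1"
  shows "inverse_positive C (mat 1 - t *\<^sub>R A)"
  unfolding inverse_positive_def
proof (intro allI impI)
  fix z
  assume y: "(mat 1 - t *\<^sub>R A) *v z \<in> C"
  define y where "y = (mat 1 - t *\<^sub>R A) *v z"
  define p where "p = closest_point C z"
  define v where "v = z - p"
  have p: "p \<in> C"
    unfolding p_def using assms(1,2) by (intro closest_point_in_set) (auto simp: convex_cone_def)
  have normal: "\<And>c. c \<in> C \<Longrightarrow> v \<bullet> c \<le> 0" "v \<bullet> p = 0"
    unfolding v_def p_def
    using closest_point_convex_cone_normal[OF assms(1,2)] by blast+
  have "v \<bullet> (A *v p) \<le> 0"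
    using assms(3) p normal by (rule invariant_continuous_normal_le_0)
  then have Ap: "t * (v \<bullet> (A *v p)) \<le> 0"
    using assms(5) by (simp add: mult_nonneg_nonpos)
  have "v \<bullet> (A *v v) \<le> norm v * norm (A *v v)"
    by (rule norm_cauchy_schwarz)
  also have "\<dots> \<le> norm v * (B * norm v)"
    using B by (intro mult_left_mono) auto
  finally have Av: "t * (v \<bullet> (A *v v)) \<le> t * B * (norm v)\<^sup>2"
    using mult_left_mono[OF _ assms(5), of "v \<bullet> (A *v v)" "norm v * (B * norm v)"]
    by (simp add: power2_eq_square mult_ac)
  have z: "z = v + p"
    by (simp add: v_def)
  have "(norm v)\<^sup>2 = v \<bullet> z"
    using normal(2) by (simp add: z inner_add_right power2_norm_eq_inner)
  also have "\<dots> = v \<bullet> (y + t *\<^sub>R (A *v z))"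
    by (simp add: y_def implicit_step_mult)
  also have "\<dots> = v \<bullet> y + t * (v \<bullet> (A *v v)) + t * (v \<bullet> (A *v p))"
    by (simp add: z matrix_vector_right_distrib inner_add_right distrib_left)
  also have "\<dots> \<le> t * B * (norm v)\<^sup>2"
    using normal(1)[OF y] Av Ap by (simp add: y_def)
  finally have "(1 - t * B) * (norm v)\<^sup>2 \<le> 0"
    by (simp add: left_diff_distrib)
  with assms(6) have "v = 0"
    by (simp add: mult_le_0_iff)
  with p show "z \<in> C"
    by (simp add: z)
qed

text \<open>
  If \<open>z\<close> were outside \<open>C\<close>, the vector \<open>u\<close> constructed below would be a point of \<open>C\<close> strictly nearer
  to \<open>z\<close> than its nearest point \<open>p\<close>.
\<close>
lemma inverse_positive_larger_step:
  fixes A :: "real^'n^'n"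
  assumes "convex_cone C" "closed C"
    and pos: "inverse_positive C (mat 1 - s *\<^sub>R A)"
    and inv: "invertible (mat 1 - s *\<^sub>R A)"
    and K: "\<And>z. norm z \<le> K * norm ((mat 1 - s *\<^sub>R A) *v z)"
    and "0 < s" "s \<le> t" "(1 - s / t) * K < 1"
  shows "inverse_positive C (mat 1 - t *\<^sub>R A)"
  unfolding inverse_positive_def
proof (intro allI impI)
  fix z
  assume y: "(mat 1 - t *\<^sub>R A) *v z \<in> C"
  define y where "y = (mat 1 - t *\<^sub>R A) *v z"
  define p where "p = closest_point C z"
  have p: "p \<in> C"
    unfolding p_def using assms(1,2) by (intro closest_point_in_set) (auto simp: convex_cone_def)
  have ratio: "0 \<le> s / t" "0 \<le> 1 - s / t"
    using assms(6,7) by auto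
  define w where "w = (s / t) *\<^sub>R y + (1 - s / t) *\<^sub>R p"
  have "w \<in> C"
    unfolding w_def
    using assms(1) y p ratio by (intro convexD) (auto simp: convex_cone_def y_def)
  obtain u where u: "(mat 1 - s *\<^sub>R A) *v u = w"
    using inv by (metis invertible_def matrix_vector_mul_assoc matrix_vector_mul_lid)
  have "u \<in> C"
    using pos u \<open>w \<in> C\<close> by (auto simp: inverse_positive_def)
  have "(mat 1 - s *\<^sub>R A) *v z = (s / t) *\<^sub>R y + (1 - s / t) *\<^sub>R z"
  proof -
    have "(s / t) *\<^sub>R y = (s / t) *\<^sub>R z - s *\<^sub>R (A *v z)"
      unfolding y_def implicit_step_mult using assms(6,7) by (simp add: scaleR_diff_right)
    then show ?thesis
      unfolding implicit_step_mult by (simp add: scaleR_diff_left)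
  qed
  then have diff: "(mat 1 - s *\<^sub>R A) *v (z - u) = (1 - s / t) *\<^sub>R (z - p)"
    using u by (simp add: matrix_vector_mult_diff_distrib w_def algebra_simps)
  have "norm (z - p) \<le> norm (z - u)"
    using closest_point_le[OF assms(2) \<open>u \<in> C\<close>, of z] by (simp add: p_def dist_norm)
  also have "\<dots> \<le> ((1 - s / t) * K) * norm (z - p)"
    using K[of "z - u"] ratio by (simp add: diff mult_ac)
  finally have "(1 - (1 - s / t) * K) * norm (z - p) \<le> 0"
    by (simp add: left_diff_distrib)
  with assms(8) have "z = p"
    by (simp add: mult_le_0_iff)
  with p show "z \<in> C" by simp
qed

section \<open>Compact intervals of step sizes\<close>

text \<open>
  The continuous function \<open>(s, z) \<mapsto> \<parallel>(I - s A) z\<parallel>\<close> is positive on the compact product of the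
  interval and the unit sphere, hence bounded away from zero there.
\<close>
lemma uniform_inverse_bound:
  fixes A :: "real^'n^'n"
  assumes "\<And>s. s \<in> {0..T} \<Longrightarrow> invertible (mat 1 - s *\<^sub>R A)"
  obtains K where "0 < K"
    "\<And>s z. s \<in> {0..T} \<Longrightarrow> norm z \<le> K * norm ((mat 1 - s *\<^sub>R A) *v z)"
proof (cases "0 \<le> T")
  case False
  then show ?thesis by (intro that[of 1]) auto
next
  case True
  let ?S = "{0..T} \<times> sphere (0::real^'n) 1"
  let ?f = "\<lambda>(s, z). norm (z - s *\<^sub>R (A *v z))"
  have "compact ?S" "?S \<noteq> {}"
    using True by (auto intro!: compact_Times)
  moreover have "continuous_on ?S ?f"
    unfolding case_prod_unfold
    by (intro continuous_intros bounded_linear.continuous_on[OF matrix_vector_mul_bounded_linear])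
  ultimately have "\<exists>q\<in>?S. \<forall>x\<in>?S. ?f q \<le> ?f x"
    by (rule continuous_attains_inf)
  then obtain q where q: "q \<in> ?S" "\<And>x. x \<in> ?S \<Longrightarrow> ?f q \<le> ?f x"
    by blast
  define m where "m = ?f q"
  obtain s0 z0 where q0: "q = (s0, z0)" by (cases q)
  have s0: "invertible (mat 1 - s0 *\<^sub>R A)" "z0 \<noteq> 0"
    using q(1) assms by (auto simp: q0)
  then have "(mat 1 - s0 *\<^sub>R A) *v z0 \<noteq> 0"
    by (metis invertible_def matrix_vector_mul_assoc matrix_vector_mul_lid matrix_vector_mult_0_right)
  then have "0 < m"
    by (simp add: m_def q0 implicit_step_mult)
  show ?thesis
  proof (rule that[of "1 / m"])
    show "0 < 1 / m" using \<open>0 < m\<close> by simp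
    fix s z
    assume s: "s \<in> {0..T}"
    show "norm z \<le> 1 / m * norm ((mat 1 - s *\<^sub>R A) *v z)"
    proof (cases "z = 0")
      case False
      let ?e = "(1 / norm z) *\<^sub>R z"
      have "m \<le> ?f (s, ?e)"
        unfolding m_def using s False by (intro q(2)) auto
      also have "\<dots> = norm ((mat 1 - s *\<^sub>R A) *v ?e)"
        by (simp add: implicit_step_mult)
      also have "\<dots> = norm ((mat 1 - s *\<^sub>R A) *v z) / norm z"
        by (simp add: matrix_vector_mult_scaleR)
      finally show ?thesis
        using False \<open>0 < m\<close> by (simp add: field_simps)
    qed simp
  qed
qed

text \<open>
  The enlargement ratio \<open>r = 1 + 1/K\<close> satisfies \<open>(1 - 1/r) K = K/(K + 1) < 1\<close>, so every step size
  below \<open>t\<^sub>0 r\<^sup>n\<close> is covered after \<open>n\<close> enlargements of a small initial one \<open>t\<^sub>0\<close>.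
\<close>
lemma inverse_positive_on_interval:
  fixes A :: "real^'n^'n"
  assumes "convex_cone C" "closed C" "invariant_continuous C A"
    and inv: "\<And>s. s \<in> {0..T} \<Longrightarrow> invertible (mat 1 - s *\<^sub>R A)"
    and "t \<in> {0..T}"
  shows "inverse_positive C (mat 1 - t *\<^sub>R A)"
proof -
  obtain B where B: "0 < B" "\<And>x. norm (A *v x) \<le> B * norm x"
    using bounded_matrix_vector_mult[of A] by blast
  obtain K where K: "0 < K"
    "\<And>s z. s \<in> {0..T} \<Longrightarrow> norm z \<le> K * norm ((mat 1 - s *\<^sub>R A) *v z)"
    using uniform_inverse_bound[of T A, OF inv] by blast
  define t0 where "t0 = 1 / (B + 1)"
  define r where "r = 1 + 1 / K"
  have t0: "0 < t0" "t0 * B < 1"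
    using B(1) by (auto simp: t0_def)
  have r: "1 < r" "(1 - 1 / r) * K < 1"
    using K(1) by (auto simp: r_def field_simps)
  have reach: "inverse_positive C (mat 1 - t *\<^sub>R A)" if "t \<in> {0..T}" "t \<le> t0 * r ^ n" for n t
    using that
  proof (induction n arbitrary: t)
    case 0
    have "t * B \<le> t0 * B"
      using 0 B(1) by (intro mult_right_mono) auto
    then show ?case
      using 0 t0(2) by (intro inverse_positive_small_step[OF assms(1-3) B(2)]) auto
  next
    case (Suc n)
    show ?case
    proof (cases "t = 0")
      case True
      then show ?thesis
        using inverse_positive_small_step[OF assms(1-3) B(2), of 0] by simp
    next
      case False
      define s where "s = t / r"
      have s: "0 < s" "s \<le> t" "s / t = 1 / r"
        using False Suc.prems(1) r(1) by (auto simp: s_def field_simps)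
      have "s \<in> {0..T}"
        using s Suc.prems(1) by auto
      moreover have "s \<le> t0 * r ^ n"
        using Suc.prems(2) r(1) by (simp add: s_def field_simps)
      ultimately show ?thesis
        using s r(2) by (intro inverse_positive_larger_step[OF assms(1,2) Suc.IH inv K(2)]) auto
    qed
  qed
  obtain n where "t / t0 < r ^ n"
    using real_arch_pow[OF r(1)] by blast
  then have "t \<le> t0 * r ^ n"
    using t0(1) by (simp add: field_simps)
  with assms(5) show ?thesis
    by (rule reach)
qed

theorem corollary4p16:
  fixes A :: "real^'n^'n" and C :: "(real^'n) set"
  assumes "proper_cone C"
    and "invariant_continuous C A"
  shows "\<forall>\<Delta>t::real. 0 \<le> \<Delta>t \<and> ereal \<Delta>t < tau_bar A \<longrightarrow>
           (\<forall>x\<in>C. backward_euler A \<Delta>t *v x \<in> C) \<and>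
           invariant_discrete C (backward_euler A \<Delta>t)"
proof (intro allI impI)
  fix h :: real
  assume h: "0 \<le> h \<and> ereal h < tau_bar A"
  then obtain \<tau> where \<tau>: "h < \<tau>" "\<And>s. s \<in> {0..\<tau>} \<Longrightarrow> invertible (mat 1 - s *\<^sub>R A)"
    unfolding tau_bar_def less_Sup_iff by auto
  have C: "convex_cone C" "closed C"
    using assms(1) by (auto simp: proper_cone_def)
  have pos: "inverse_positive C (mat 1 - h *\<^sub>R A)"
    using h \<tau> by (intro inverse_positive_on_interval[OF C assms(2) \<tau>(2)]) auto
  have "invertible (mat 1 - h *\<^sub>R A)"
    using h \<tau> by auto
  then have "(mat 1 - h *\<^sub>R A) ** backward_euler A h = mat 1"
    unfolding invertible_def backward_euler_def matrix_inv_def by (rule someI2_ex) simp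
  then have "(mat 1 - h *\<^sub>R A) *v (backward_euler A h *v x) = x" for x
    by (simp add: matrix_vector_mul_assoc)
  then have step: "\<forall>x\<in>C. backward_euler A h *v x \<in> C"
    using pos unfolding inverse_positive_def by metis
  then show "(\<forall>x\<in>C. backward_euler A h *v x \<in> C) \<and>
      invariant_discrete C (backward_euler A h)"
    by (simp add: invariant_discrete_def)
qed

end
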